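(* Let $1<p<\infty$ and let $L_p$ be the $L_p$ space over a measure space, with its usual norm $\|\cdot\|_p$. Then there exists $m>0$ such that for all $F,G\in L_p$ $$\max\big(\|F+G\|_p,\|F-G\|_p\big)\ge\Big(\|F\|_p^{\max(p,2)}+m\|G\|_p^{\max(p,2)}\Big)^{1/\max(p,2)} .$$ *)

theory Defs
  imports "HOL-Analysis.Analysis"
begin

text \<open>
  Elements of \<open>L_p\<close> are given by representatives: functions equal almost everywhere are not
  identified, so for \<open>p \<ge> 1\<close> \<open>Lp_norm\<close> is a seminorm on \<open>Lp_space\<close>. Both notions are unaffected by
  passing to another measurable function that agrees almost everywhere.
\<close>

definition Lp_space :: "real \<Rightarrow> 'a measure \<Rightarrow> ('a \<Rightarrow> 'k::{real_normed_field, euclidean_space}) set"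
  where "Lp_space p M = {f \<in> borel_measurable M. integrable M (\<lambda>x. norm (f x) powr p)}"

definition Lp_norm :: "real \<Rightarrow> 'a measure \<Rightarrow> ('a \<Rightarrow> 'k::{real_normed_field, euclidean_space}) \<Rightarrow> real"
  where "Lp_norm p M f = (\<integral>x. norm (f x) powr p \<partial>M) powr (1 / p)"

text \<open>
  The sort of \<open>'k\<close> stands for the scalar field: a finite-dimensional real normed field is isometrically
  isomorphic to the reals or the complex numbers, and both types are instances.
\<close>

lemma "OFCLASS(real, real_normed_field_class)" "OFCLASS(real, euclidean_space_class)"
  by intro_classes

lemma "OFCLASS(complex, real_normed_field_class)" "OFCLASS(complex, euclidean_space_class)"
  by intro_classes

end

theory Submission
  imports Defs
begin

text \<open>
  Put \<open>r = max p 2\<close>. The maximum of two norms is at least the \<open>p\<close>-th power mean of them, and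
  the \<open>p\<close>-th power of that mean is the integral of \<open>H = (\<bar>F + G\<bar> powr p + \<bar>F - G\<bar> powr p) / 2\<close>. So it suffices to
  bound \<open>H\<close> below pointwise and to carry the bound through the integral.

  The pointwise bound (\<open>mean_powr_lower_bound\<close>) is
  \<open>\<bar>a\<bar> powr r + m * \<bar>b\<bar> powr r \<le> H powr (r / p)\<close> with \<open>m = min 1 (p - 1)\<close>. It uses only that the norm
  of the scalars comes from an inner product. For \<open>p \<ge> 2\<close> the power mean of order \<open>p\<close> dominates the
  one of order \<open>2\<close>, whose square is \<open>\<bar>a\<bar>\<^sup>2 + \<bar>b\<bar>\<^sup>2\<close> by the parallelogram law. For
  \<open>p < 2\<close> the parallelogram law reduces the bound to the two-point inequality for two real numbers
  (\<open>two_point_inequality\<close>), which after scaling is an estimate of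
  \<open>(1 + t) powr p + (1 - t) powr p\<close> by its second-order Taylor polynomial at \<open>0\<close>.

  With \<open>s = r / p \<ge> 1\<close>, \<open>U = \<bar>F\<bar> powr p\<close> and \<open>V = \<bar>G\<bar> powr p\<close>, the pointwise bound says that \<open>H\<close>
  dominates a weighted \<open>l_s\<close> norm of the vector \<open>(U, V)\<close>. The norm of an integral is at most the
  integral of the norm (\<open>minkowski_integral_pair\<close>), so the same bound holds between the integrals of
  \<open>U\<close>, \<open>V\<close> and \<open>H\<close>, that is between \<open>p\<close>-th powers of norms in \<open>L_p\<close>.
\<close>

section \<open>Elementary inequalities for real powers\<close>

text \<open>Bernoulli's inequality for exponents at most \<open>1\<close>: it is the weighted inequality of arithmetic
  and geometric means for \<open>1 + z\<close> and \<open>1\<close>.\<close>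

lemma powr_one_plus_le:
  fixes z \<theta> :: real
  assumes "0 \<le> z" "0 \<le> \<theta>" "\<theta> \<le> 1"
  shows "(1 + z) powr \<theta> \<le> 1 + \<theta> * z"
proof -
  have "(1 + z) powr \<theta> * 1 powr (1 - \<theta>) \<le> \<theta> * (1 + z) + (1 - \<theta>) * 1"
    using assms by (intro Youngs_inequality_0) auto
  then show ?thesis
    by (simp add: algebra_simps)
qed

text \<open>Factoring \<open>u powr q = u * u powr (q - 1)\<close> and enlarging the second factor to
  \<open>(x + y) powr (q - 1)\<close> turns both summands into shares of the right-hand side.\<close>

lemma powr_add_superadditive:
  fixes x y q :: real
  assumes "0 \<le> x" "0 \<le> y" "1 \<le> q"
  shows "x powr q + y powr q \<le> (x + y) powr q"
proof -
  have split: "u powr q = u * u powr (q - 1)" if "0 \<le> u" for u :: real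
    using that by (cases "u = 0") (simp_all add: powr_diff)
  have "x powr q + y powr q = x * x powr (q - 1) + y * y powr (q - 1)"
    using assms by (simp add: split)
  also have "\<dots> \<le> x * (x + y) powr (q - 1) + y * (x + y) powr (q - 1)"
    using assms by (intro add_mono mult_left_mono powr_mono2) auto
  also have "\<dots> = (x + y) powr q"
    using assms by (simp add: split distrib_right)
  finally show ?thesis .
qed

text \<open>The lemma \<open>powr_convex\<close> covers positive arguments only. The functions to which convexity is applied
  below may vanish, so the boundary point \<open>0\<close> is included here.\<close>

lemma powr_convex_nonneg:
  fixes q :: real
  assumes "1 \<le> q"
  shows "convex_on {0..} (\<lambda>x. x powr q)"
proof (rule convex_onI)
  fix t x y :: real
  assume t: "0 < t" "t < 1" and xy: "x \<in> {0..}" "y \<in> {0..}"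
  have scale: "(u * z) powr q \<le> u * z powr q" if "0 < u" "u < 1" "0 \<le> z" for u z :: real
    using that assms powr_le_one_le[of u q] by (simp add: powr_mult mult_right_mono)
  consider "x = 0" | "y = 0" | "0 < x" "0 < y"
    using xy by fastforce
  then show "((1 - t) *\<^sub>R x + t *\<^sub>R y) powr q \<le> (1 - t) * x powr q + t * y powr q"
  proof cases
    case 1
    then show ?thesis using scale[of t y] t xy by simp
  next
    case 2
    then show ?thesis using scale[of "1 - t" x] t xy by simp
  next
    case 3
    then show ?thesis
      using convex_onD[OF powr_convex[OF assms], of t x y] t by simp
  qed
qed simp

section \<open>The two-point inequality\<close>

text \<open>The second derivative of the right-hand side is \<open>p * (p - 1)\<close> times the mean of
  \<open>(1 + t) powr (p - 2)\<close> and \<open>(1 - t) powr (p - 2)\<close>. Their geometric mean is a nonpositive power of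
  \<open>1 - t\<^sup>2\<close>, hence at least \<open>1\<close>, so the function grows at least as fast as the quadratic polynomial
  with the same value and slope at \<open>0\<close>.\<close>

lemma two_point_lower_bound:
  fixes p t :: real
  assumes p: "1 < p" "p \<le> 2" and t: "0 \<le> t" "t \<le> 1"
  shows "1 + p / 2 * ((p - 1) * t\<^sup>2) \<le> ((1 + t) powr p + (1 - t) powr p) / 2"
proof -
  \<comment> \<open>Up to an additive constant, \<open>\<phi>\<close> is twice the difference of the two sides, and \<open>p * \<psi>\<close> is its derivative.\<close>
  define \<psi> where "\<psi> = (\<lambda>s::real. (1 + s) powr (p - 1) - (1 - s) powr (p - 1) - 2 * (p - 1) * s)"
  define \<phi> where "\<phi> = (\<lambda>s::real. (1 + s) powr p + (1 - s) powr p - p * (p - 1) * s\<^sup>2)"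
  have \<psi>_nonneg: "0 \<le> \<psi> s" if s: "0 < s" "s < 1" for s
  proof -
    have "\<psi> 0 \<le> \<psi> s"
    proof (rule DERIV_nonneg_imp_nondecreasing[of 0 s \<psi>])
      show "0 \<le> s" using s by simp
      fix u assume u: "0 \<le> u" "u \<le> s"
      let ?D = "(p - 1) * ((1 + u) powr (p - 2) + (1 - u) powr (p - 2) - 2)"
      have "DERIV \<psi> u :> ?D"
        unfolding \<psi>_def using u s
        by (auto intro!: derivative_eq_intros simp: algebra_simps)
      moreover have "0 \<le> ?D"
      proof -
        have "1 \<le> (1 - u\<^sup>2) powr ((p - 2) / 2)"
        proof -
          have "u\<^sup>2 < 1"
            using u s by (simp add: power_less_one_iff abs_square_less_1)
          then show ?thesis
            using powr_mono2'[of "(p - 2) / 2" "1 - u\<^sup>2" 1] p by simp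
        qed
        also have "\<dots> = (1 + u) powr ((p - 2) / 2) * (1 - u) powr ((p - 2) / 2)"
          using u s by (simp add: powr_mult[symmetric] power2_eq_square algebra_simps)
        also have "2 * \<dots> \<le> ((1 + u) powr ((p - 2) / 2))\<^sup>2 + ((1 - u) powr ((p - 2) / 2))\<^sup>2"
          using sum_squares_bound[of "(1 + u) powr ((p - 2) / 2)" "(1 - u) powr ((p - 2) / 2)"]
          by simp
        also have "\<dots> = (1 + u) powr (p - 2) + (1 - u) powr (p - 2)"
          by (simp add: power2_eq_square powr_add[symmetric])
        finally show ?thesis
          using p by simp
      qed
      ultimately show "\<exists>y. DERIV \<psi> u :> y \<and> 0 \<le> y" by blast
    qed
    then show ?thesis by (simp add: \<psi>_def)
  qed
  have "\<phi> 0 \<le> \<phi> t"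
  proof (rule DERIV_nonneg_imp_increasing_open[of 0 t \<phi>])
    fix s assume s: "0 < s" "s < t"
    have "DERIV \<phi> s :> p * \<psi> s"
      unfolding \<phi>_def \<psi>_def using s t
      by (auto intro!: derivative_eq_intros simp: algebra_simps)
    moreover have "0 \<le> p * \<psi> s"
      using \<psi>_nonneg[of s] s t p by simp
    ultimately show "\<exists>y. DERIV \<phi> s :> y \<and> 0 \<le> y" by blast
  next
    \<comment> \<open>At \<open>t = 1\<close> the function \<open>(1 - s) powr p\<close> is still continuous because \<open>p > 0\<close>; only the
      interior is differentiated.\<close>
    show "continuous_on {0..t} \<phi>"
      unfolding \<phi>_def using p t by (intro continuous_intros continuous_on_powr') auto
  qed (use t in simp)
  then show ?thesis
    by (simp add: \<phi>_def field_simps)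
qed

text \<open>Both sides are symmetric in \<open>x\<close> and \<open>y\<close> and homogeneous of degree \<open>p\<close>. Dividing by the
  arithmetic mean \<open>c\<close> leaves the pair \<open>1 + t\<close>, \<open>1 - t\<close>, and the claim follows from the quadratic lower
  bound of the power mean and Bernoulli's upper bound of the left-hand side.\<close>

lemma two_point_inequality:
  fixes p x y :: real
  assumes p: "1 < p" "p \<le> 2" and xy: "0 \<le> x" "0 \<le> y"
  shows "(((x + y) / 2)\<^sup>2 + (p - 1) * ((x - y) / 2)\<^sup>2) powr (p / 2) \<le> (x powr p + y powr p) / 2"
  using xy
proof (induction x y rule: linorder_wlog)
  case (sym a b)
  then show ?case
    by (simp add: add.commute power2_commute[of a b] power_divide)
next
  case (le y x)
  show ?case
  proof (cases "x = 0")
    case True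
    then show ?thesis using le by simp
  next
    case False
    define c t where "c = (x + y) / 2" and "t = (x - y) / (x + y)"
    have c: "0 < c" and t: "0 \<le> t" "t \<le> 1"
      using False le by (auto simp: c_def t_def)
    have x: "x = c * (1 + t)" and y: "y = c * (1 - t)"
      using False le by (auto simp: c_def t_def field_simps)
    have "((x + y) / 2)\<^sup>2 + (p - 1) * ((x - y) / 2)\<^sup>2 = c\<^sup>2 * (1 + (p - 1) * t\<^sup>2)"
      by (simp add: x y power2_eq_square algebra_simps)
    then have "(((x + y) / 2)\<^sup>2 + (p - 1) * ((x - y) / 2)\<^sup>2) powr (p / 2)
        = c powr p * (1 + (p - 1) * t\<^sup>2) powr (p / 2)"
      using c p by (simp add: powr_mult powr_powr flip: powr_numeral)
    also have "\<dots> \<le> c powr p * (1 + p / 2 * ((p - 1) * t\<^sup>2))"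
      using p by (intro mult_left_mono powr_one_plus_le) auto
    also have "\<dots> \<le> c powr p * (((1 + t) powr p + (1 - t) powr p) / 2)"
      using p t by (intro mult_left_mono two_point_lower_bound) auto
    also have "\<dots> = (x powr p + y powr p) / 2"
      unfolding x y powr_mult by (simp only: distrib_left times_divide_eq_right)
    finally show ?thesis 
      by (simp add: add.commute power2_commute[of x y] power_divide)
  qed
qed

section \<open>The pointwise lower bound in an inner product space\<close>

lemma parallelogram_law:
  fixes a b :: "'b::real_inner"
  shows "(norm (a + b))\<^sup>2 + (norm (a - b))\<^sup>2 = 2 * ((norm a)\<^sup>2 + (norm b)\<^sup>2)"
  by (simp add: power2_norm_eq_inner inner_add inner_diff algebra_simps)

text \<open>Let \<open>x\<close> and \<open>y\<close> be the norms of \<open>a + b\<close> and \<open>a - b\<close>. By the parallelogram law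
  \<open>\<bar>a\<bar>\<^sup>2 + \<bar>b\<bar>\<^sup>2\<close> depends only on \<open>x\<close> and \<open>y\<close>, so for fixed \<open>x\<close> and \<open>y\<close> the left-hand side, which
  equals \<open>\<bar>a\<bar>\<^sup>2 + \<bar>b\<bar>\<^sup>2 - (2 - p) * \<bar>b\<bar>\<^sup>2\<close>, is largest when \<open>\<bar>b\<bar>\<close> is as small as the triangle
  inequality permits, namely \<open>\<bar>x - y\<bar> / 2\<close>. That extreme case, in which \<open>a\<close> and \<open>b\<close> are parallel,
  is the two-point inequality for \<open>x\<close> and \<open>y\<close>.\<close>

lemma mean_powr_lower_bound_le_2:
  fixes a b :: "'b::real_inner" and p :: real
  assumes p: "1 < p" "p \<le> 2"
  shows "(norm a)\<^sup>2 + (p - 1) * (norm b)\<^sup>2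
    \<le> ((norm (a + b) powr p + norm (a - b) powr p) / 2) powr (2 / p)"
proof -
  let ?x = "norm (a + b)" and ?y = "norm (a - b)"
  let ?E = "((?x + ?y) / 2)\<^sup>2 + (p - 1) * ((?x - ?y) / 2)\<^sup>2"
  have "\<bar>?x - ?y\<bar> \<le> 2 * norm b"
    using norm_triangle_ineq3[of "a + b" "a - b"] by (simp add: scaleR_2[symmetric])
  then have "((?x - ?y) / 2)\<^sup>2 \<le> (norm b)\<^sup>2"
    by (simp add: abs_le_square_iff[symmetric])
  then have "(2 - p) * ((?x - ?y) / 2)\<^sup>2 \<le> (2 - p) * (norm b)\<^sup>2"
    using p by (intro mult_left_mono) auto
  moreover have "(norm a)\<^sup>2 + (norm b)\<^sup>2 = ?E + (2 - p) * ((?x - ?y) / 2)\<^sup>2"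
  proof -
    have "?E + (2 - p) * ((?x - ?y) / 2)\<^sup>2 = (?x\<^sup>2 + ?y\<^sup>2) / 2"
      by (simp add: power2_eq_square field_simps)
    then show ?thesis
      using parallelogram_law[of a b] by simp
  qed
  ultimately have "(norm a)\<^sup>2 + (p - 1) * (norm b)\<^sup>2 \<le> ?E"
    by (simp add: left_diff_distrib)
  also have "?E = (?E powr (p / 2)) powr (2 / p)"
    using p by (simp add: powr_powr)
  also have "\<dots> \<le> ((?x powr p + ?y powr p) / 2) powr (2 / p)"
    using p by (intro powr_mono2 two_point_inequality) auto
  finally show ?thesis .
qed

text \<open>With \<open>q = p / 2 \<ge> 1\<close>, convexity of \<open>u powr q\<close> bounds the mean below by the \<open>q\<close>-th power of
  \<open>\<bar>a\<bar>\<^sup>2 + \<bar>b\<bar>\<^sup>2\<close>, and superadditivity of \<open>u powr q\<close> splits that power.\<close>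

lemma mean_powr_lower_bound_ge_2:
  fixes a b :: "'b::real_inner" and p :: real
  assumes p: "2 \<le> p"
  shows "norm a powr p + norm b powr p \<le> (norm (a + b) powr p + norm (a - b) powr p) / 2"
proof -
  have sq: "norm v powr p = ((norm v)\<^sup>2) powr (p / 2)" for v :: 'b
    using p by (cases "v = 0") (simp_all add: powr_powr flip: powr_numeral)
  have "norm a powr p + norm b powr p \<le> ((norm a)\<^sup>2 + (norm b)\<^sup>2) powr (p / 2)"
    unfolding sq using p by (intro powr_add_superadditive) auto
  also have "\<dots> = (1 / 2 * (norm (a + b))\<^sup>2 + 1 / 2 * (norm (a - b))\<^sup>2) powr (p / 2)"
  proof -
    have "(norm a)\<^sup>2 + (norm b)\<^sup>2 = 1 / 2 * (norm (a + b))\<^sup>2 + 1 / 2 * (norm (a - b))\<^sup>2"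
      using parallelogram_law[of a b] by simp
    then show ?thesis by (simp only:)
  qed
  also have "\<dots> \<le> 1 / 2 * ((norm (a + b))\<^sup>2) powr (p / 2) + 1 / 2 * ((norm (a - b))\<^sup>2) powr (p / 2)"
    using p convex_onD[OF powr_convex_nonneg[of "p / 2"], of "1 / 2" "(norm (a + b))\<^sup>2" "(norm (a - b))\<^sup>2"]
    by simp
  finally show ?thesis
    by (simp add: sq)
qed

lemma mean_powr_lower_bound:
  fixes a b :: "'b::real_inner" and p :: real
  assumes p: "1 < p"
  shows "norm a powr max p 2 + min 1 (p - 1) * norm b powr max p 2
    \<le> ((norm (a + b) powr p + norm (a - b) powr p) / 2) powr (max p 2 / p)"
proof (cases "p \<le> 2")
  case True
  then show ?thesis
    using mean_powr_lower_bound_le_2[OF p True, of a b] by (simp add: max_absorb2 min_absorb2)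
next
  case False
  then show ?thesis
    using mean_powr_lower_bound_ge_2[of p a b] by (simp add: max_def min_def)
qed

section \<open>Integrating the pointwise bound\<close>

text \<open>The smallest admissible \<open>H\<close> is a weighted \<open>l_s\<close> norm of \<open>(U, V)\<close> (a seminorm if \<open>m = 0\<close>), so
  this is the triangle inequality for integrals of functions with values in the plane. It holds because
  a norm lies above each of its supporting functionals: the functional that supports the norm at the
  vector \<open>(A, B)\<close> of integrals is integrated, and at \<open>(A, B)\<close> it attains the norm. For
  \<open>U = \<bar>f\<bar> powr p\<close>, \<open>V = \<bar>g\<bar> powr p\<close> and \<open>s = 2 / p\<close> it is the reverse Minkowski inequality in
  \<open>L_q\<close> with \<open>q = p / 2 \<le> 1\<close> for \<open>f\<^sup>2\<close> and \<open>g\<^sup>2\<close>.\<close>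

lemma minkowski_integral_pair:
  fixes U V H :: "'a \<Rightarrow> real" and s m :: real
  assumes s: "1 \<le> s" and m: "0 \<le> m"
    and int: "integrable M U" "integrable M V" "integrable M H"
    and nonneg: "\<And>x. 0 \<le> U x" "\<And>x. 0 \<le> V x" "\<And>x. 0 \<le> H x"
    and le: "\<And>x. U x powr s + m * V x powr s \<le> H x powr s"
  shows "(\<integral>x. U x \<partial>M) powr s + m * (\<integral>x. V x \<partial>M) powr s \<le> (\<integral>x. H x \<partial>M) powr s"
proof -
  define A B where "A = (\<integral>x. U x \<partial>M)" and "B = (\<integral>x. V x \<partial>M)"
  define T where "T = A powr s + m * B powr s"
  have AB: "0 \<le> A" "0 \<le> B"
    using nonneg by (auto simp: A_def B_def)
  show ?thesis
  proof (cases "T = 0")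
    case True
    then show ?thesis by (simp add: T_def A_def B_def)
  next
    case False
    have "0 < T"
      using False m by (simp add: T_def less_le)
    define \<nu> \<mu> where "\<nu> = A powr s / T" and "\<mu> = m * B powr s / T"
    have sum_1: "\<nu> + \<mu> = 1"
      unfolding \<nu>_def \<mu>_def using \<open>0 < T\<close> by (simp add: add_divide_distrib[symmetric] T_def[symmetric])
    have wt: "0 \<le> \<nu>" "0 \<le> \<mu>" "\<nu> = 1 - \<mu>"
      using sum_1 \<open>0 < T\<close> m by (auto simp: \<nu>_def \<mu>_def)
    \<comment> \<open>The left-hand side is the supporting functional at \<open>(A, B)\<close>, evaluated at \<open>(U x, V x)\<close>. If
      \<open>A = 0\<close> then \<open>\<nu> = 0\<close>, so the default value of
      \<open>U x / A\<close> does no harm; likewise for \<open>B\<close>.\<close>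
    have tangent: "T powr (1 / s) * (\<nu> * (U x / A) + \<mu> * (V x / B)) \<le> H x" for x
    proof -
      let ?K = "\<nu> * (U x / A) + \<mu> * (V x / B)"
      have K: "0 \<le> ?K"
        using wt AB nonneg by simp
      have U: "\<nu> * (U x / A) powr s \<le> U x powr s / T"
        using AB nonneg \<open>0 < T\<close> by (cases "A = 0") (auto simp: \<nu>_def powr_divide)
      have V: "\<mu> * (V x / B) powr s \<le> m * V x powr s / T"
        using AB nonneg m \<open>0 < T\<close> by (cases "B = 0") (auto simp: \<mu>_def powr_divide)
      have "?K powr s \<le> \<nu> * (U x / A) powr s + \<mu> * (V x / B) powr s"
        using convex_onD[OF powr_convex_nonneg[OF s], of \<mu> "U x / A" "V x / B"] wt AB nonneg
        by simp
      also have "\<dots> \<le> (U x powr s + m * V x powr s) / T"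
        using U V by (simp add: add_divide_distrib)
      also have "\<dots> \<le> H x powr s / T"
        using le \<open>0 < T\<close> by (intro divide_right_mono) auto
      finally have "T * ?K powr s \<le> H x powr s"
        using \<open>0 < T\<close> by (simp add: field_simps)
      then have "(T * ?K powr s) powr (1 / s) \<le> (H x powr s) powr (1 / s)"
        using \<open>0 < T\<close> s by (intro powr_mono2) auto
      then show ?thesis
        using \<open>0 < T\<close> s K nonneg by (simp add: powr_mult powr_powr)
    qed
    have "\<nu> * (A / A) + \<mu> * (B / B) = 1"
      using sum_1 by (cases "A = 0"; cases "B = 0") (auto simp: \<nu>_def \<mu>_def)
    then have "T powr (1 / s) = (\<integral>x. T powr (1 / s) * (\<nu> * (U x / A) + \<mu> * (V x / B)) \<partial>M)"
      using int by (cases "A = 0"; cases "B = 0") (simp_all add: A_def[symmetric] B_def[symmetric])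
    also have "\<dots> \<le> (\<integral>x. H x \<partial>M)"
      using int tangent by (intro integral_mono) auto
    finally have "(T powr (1 / s)) powr s \<le> (\<integral>x. H x \<partial>M) powr s"
      using s by (intro powr_mono2) auto
    then show ?thesis
      using \<open>0 < T\<close> s by (simp add: powr_powr T_def A_def B_def)
  qed
qed

section \<open>The inequality in \<open>L_p\<close>\<close>

text \<open>Integrability of \<open>\<bar>F + G\<bar> powr p\<close> is essential below: the integral of a nonintegrable function
  is \<open>0\<close> by convention, which would falsify a lower bound for it.\<close>

lemma Lp_space_add:
  assumes p: "0 < p" and F: "F \<in> Lp_space p M" and G: "G \<in> Lp_space p M"
  shows "(\<lambda>x. F x + G x) \<in> Lp_space p M"
proof -
  have [measurable]: "F \<in> borel_measurable M" "G \<in> borel_measurable M"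
    using F G by (auto simp: Lp_space_def)
  have "integrable M (\<lambda>x. norm (F x + G x) powr p)"
  proof (rule Bochner_Integration.integrable_bound)
    show "integrable M (\<lambda>x. 2 powr p * (norm (F x) powr p + norm (G x) powr p))"
      using F G by (auto simp: Lp_space_def)
    have "norm (F x + G x) powr p \<le> 2 powr p * (norm (F x) powr p + norm (G x) powr p)" for x
    proof -
      have "norm (F x + G x) powr p \<le> (2 * max (norm (F x)) (norm (G x))) powr p"
        using p norm_triangle_ineq[of "F x" "G x"] by (intro powr_mono2) auto
      also have "\<dots> \<le> 2 powr p * (norm (F x) powr p + norm (G x) powr p)"
        by (simp add: powr_mult max_def)
      finally show ?thesis .
    qed
    then show "AE x in M. norm (norm (F x + G x) powr p)
        \<le> norm (2 powr p * (norm (F x) powr p + norm (G x) powr p))"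
      by simp
  qed simp
  then show ?thesis
    by (simp add: Lp_space_def)
qed

lemma Lp_space_diff:
  assumes p: "0 < p" and F: "F \<in> Lp_space p M" and G: "G \<in> Lp_space p M"
  shows "(\<lambda>x. F x - G x) \<in> Lp_space p M"
proof -
  have "(\<lambda>x. - G x) \<in> Lp_space p M"
    using G by (simp add: Lp_space_def)
  from Lp_space_add[OF p F this] show ?thesis by simp
qed

lemma Lp_norm_powr:
  assumes "0 < p"
  shows "Lp_norm p M f powr q = (\<integral>x. norm (f x) powr p \<partial>M) powr (q / p)"
  by (simp add: Lp_norm_def powr_powr)

theorem corollary3p2:
  fixes M :: "'a measure" and p :: real
  assumes "1 < p"
  shows "\<exists>m>0. \<forall>F \<in> Lp_space p M. \<forall>G \<in> (Lp_space p M :: ('a \<Rightarrow> 'k::{real_normed_field, euclidean_space}) set).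
    max (Lp_norm p M (\<lambda>x. F x + G x)) (Lp_norm p M (\<lambda>x. F x - G x))
      \<ge> (Lp_norm p M F powr max p 2 + m * Lp_norm p M G powr max p 2) powr (1 / max p 2)"
proof (intro exI conjI ballI)
  let ?m = "min 1 (p - 1)" and ?r = "max p 2"
  show "0 < ?m" using assms by simp
  fix F G :: "'a \<Rightarrow> 'k"
  assume F: "F \<in> Lp_space p M" and G: "G \<in> Lp_space p M"
  let ?I = "\<lambda>f :: 'a \<Rightarrow> 'k. \<integral>x. norm (f x) powr p \<partial>M"
  let ?S = "\<lambda>x. F x + G x" and ?D = "\<lambda>x. F x - G x"
  let ?N = "max (Lp_norm p M ?S) (Lp_norm p M ?D)"
  have int: "integrable M (\<lambda>x. norm (F x) powr p)" "integrable M (\<lambda>x. norm (G x) powr p)"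
      "integrable M (\<lambda>x. norm (F x + G x) powr p)" "integrable M (\<lambda>x. norm (F x - G x) powr p)"
    using F G Lp_space_add[of p F M G] Lp_space_diff[of p F M G] assms
    by (auto simp: Lp_space_def)
  have N: "0 \<le> ?N"
    by (simp add: Lp_norm_def le_max_iff_disj)
  have "Lp_norm p M F powr ?r + ?m * Lp_norm p M G powr ?r
      = ?I F powr (?r / p) + ?m * ?I G powr (?r / p)"
    using assms by (simp add: Lp_norm_powr)
  also have "\<dots> \<le> (\<integral>x. (norm (?S x) powr p + norm (?D x) powr p) / 2 \<partial>M) powr (?r / p)"
  proof (rule minkowski_integral_pair)
    show "(norm (F x) powr p) powr (?r / p) + ?m * (norm (G x) powr p) powr (?r / p)
        \<le> ((norm (?S x) powr p + norm (?D x) powr p) / 2) powr (?r / p)" for x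
      using mean_powr_lower_bound[OF assms, of "F x" "G x"] assms by (simp add: powr_powr)
  qed (use assms int in auto)
  also have "\<dots> = ((?I ?S + ?I ?D) / 2) powr (?r / p)"
    using int by simp
  also have "\<dots> \<le> (?N powr p) powr (?r / p)"
  proof (intro powr_mono2)
    have "Lp_norm p M ?S powr p \<le> ?N powr p" "Lp_norm p M ?D powr p \<le> ?N powr p"
      using assms by (auto intro!: powr_mono2 simp: Lp_norm_def)
    then show "(?I ?S + ?I ?D) / 2 \<le> ?N powr p"
      using assms by (simp add: Lp_norm_powr)
  qed (use assms in auto)
  also have "\<dots> = ?N powr ?r"
    using assms by (simp add: powr_powr)
  finally have "(Lp_norm p M F powr ?r + ?m * Lp_norm p M G powr ?r) powr (1 / ?r)
      \<le> (?N powr ?r) powr (1 / ?r)"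
    using assms by (intro powr_mono2) auto
  also have "\<dots> = ?N"
    using N by (simp add: powr_powr)
  finally show "(Lp_norm p M F powr ?r + ?m * Lp_norm p M G powr ?r) powr (1 / ?r) \<le> ?N" .
qed

end
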